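(* Let $f(\cdot;\boldsymbol\lambda)$, $\boldsymbol\lambda\in\boldsymbol\Lambda$, and $\psi(\cdot;\boldsymbol\theta)$, $\boldsymbol\theta\in\boldsymbol\Theta\subset\mathbb R^d$, be families of probability densities on $\mathcal X\subset\mathbb R^s$, and let $X_1,\dots,X_n$ be i.i.d. with density $f(\cdot;\boldsymbol\lambda_0)$ (the null hypothesis with true null parameter $\boldsymbol\lambda_0$). Assume $\mathbb C(\boldsymbol\theta,\boldsymbol\theta)<\infty$ for all $\boldsymbol\theta\in\boldsymbol\Theta$ and $\mathrm{supp}[\psi(\cdot;\boldsymbol\theta)]\subset\mathrm{supp}[f(\cdot;\boldsymbol\lambda_0)]$ for each $\boldsymbol\theta\in\boldsymbol\Theta$. Then the process $$n^{-1/2}S(\boldsymbol\theta|\boldsymbol\lambda_0)-n^{-1/2}\,\mathbb C^T(\boldsymbol\theta|\boldsymbol\lambda_0)\,[\mathbf I(\boldsymbol\lambda_0)]^{-1}\sum_{i=1}^n\nabla l(\boldsymbol\lambda_0|X_i),\qquad\boldsymbol\theta\in\boldsymbol\Theta,$$ has the covariance function $$\mathbb C^\star(\boldsymbol\theta,\boldsymbol\theta^\dagger)=\mathbb C(\boldsymbol\theta,\boldsymbol\theta^\dagger)-\mathbb C^T(\boldsymbol\theta|\boldsymbol\lambda_0)\,[\mathbf I(\boldsymbol\lambda_0)]^{-1}\,\mathbb C(\boldsymbol\theta^\dagger|\boldsymbol\lambda_0).$$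
   Context: $\mathbb C(\boldsymbol\theta,\boldsymbol\theta^\dagger)=\int\frac{\psi(x;\boldsymbol\theta)\psi(x;\boldsymbol\theta^\dagger)}{f(x;\boldsymbol\lambda_0)}dx-1$. Score process: $S(\boldsymbol\theta|\boldsymbol\lambda)=\sum_{i=1}^n\left[\frac{\psi(X_i;\boldsymbol\theta)}{f(X_i;\boldsymbol\lambda)}-1\right]$. $l(\boldsymbol\lambda|x)=\log f(x;\boldsymbol\lambda)$; $\nabla l(\boldsymbol\lambda|x)$ is its vector of partial derivatives in $\boldsymbol\lambda$; $\mathbf I(\boldsymbol\lambda_0)$ is the Fisher information matrix. The standard likelihood regularity conditions at $\boldsymbol\lambda_0$ are assumed, so that $\nabla l(\boldsymbol\lambda_0|X_1)$ has mean zero and covariance matrix $\mathbf I(\boldsymbol\lambda_0)$, which is invertible. Covariance vector: $\mathbb C(\boldsymbol\theta|\boldsymbol\lambda_0)=\mathrm{cov}\left[\frac{\psi(X_1;\boldsymbol\theta)}{f(X_1;\boldsymbol\lambda_0)}-1,\ \nabla l(\boldsymbol\lambda_0|X_1)\right]=\int\psi(x;\boldsymbol\theta)\nabla l(\boldsymbol\lambda_0|x)\,dx$. *)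

theory Defs
  imports "HOL-Probability.Probability"
begin

definition prob_density_on :: "'a::euclidean_space set \<Rightarrow> ('a \<Rightarrow> real) \<Rightarrow> bool" where
  "prob_density_on \<X> g \<longleftrightarrow>
     g \<in> borel_measurable (restrict_space lborel \<X>) \<and> (\<forall>x\<in>\<X>. 0 \<le> g x) \<and>
     (\<integral>\<^sup>+x. ennreal (g x) \<partial>restrict_space lborel \<X>) = 1"

text \<open>The topological support relative to \<open>\<X>\<close>.  An inclusion between the sets where
  two densities are positive implies the inclusion between their supports in this sense, so
  assuming the latter covers both common meanings of the word.\<close>

definition supp_on :: "'a::topological_space set \<Rightarrow> ('a \<Rightarrow> real) \<Rightarrow> 'a set" where
  "supp_on \<X> g = \<X> \<inter> closure {x \<in> \<X>. g x \<noteq> 0}"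

definition density_law :: "'a::euclidean_space set \<Rightarrow> ('a \<Rightarrow> real) \<Rightarrow> 'a measure" where
  "density_law \<X> g = density (restrict_space lborel \<X>) (\<lambda>x. ennreal (g x))"

definition covariance :: "'w measure \<Rightarrow> ('w \<Rightarrow> real) \<Rightarrow> ('w \<Rightarrow> real) \<Rightarrow> real" where
  "covariance M U V =
     (\<integral>w. (U w - (\<integral>v. U v \<partial>M)) * (V w - (\<integral>v. V v \<partial>M)) \<partial>M)"

text \<open>Second moments are required to exist, because the Bochner integral of a
  non-integrable function is \<open>0\<close>.  The covariance function is extended real valued
  so that it can be compared with \<open>cov_psi\<close> below; the equation forces finiteness.\<close>

definition has_covariance_function ::
  "'w measure \<Rightarrow> 't set \<Rightarrow> ('t \<Rightarrow> 'w \<Rightarrow> real) \<Rightarrow> ('t \<Rightarrow> 't \<Rightarrow> ereal) \<Rightarrow> bool" where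
  "has_covariance_function M T Z K \<longleftrightarrow>
     (\<forall>t\<in>T. Z t \<in> borel_measurable M \<and> integrable M (\<lambda>w. (Z t w)\<^sup>2)) \<and>
     (\<forall>t\<in>T. \<forall>u\<in>T. ereal (covariance M (Z t) (Z u)) = K t u)"

definition partials :: "(real^'p \<Rightarrow> real) \<Rightarrow> real^'p \<Rightarrow> real^'p" where
  "partials h a = (\<chi> j. deriv (\<lambda>t. h (a + t *\<^sub>R axis j 1)) 0)"

definition loglik :: "('l \<Rightarrow> 'a \<Rightarrow> real) \<Rightarrow> 'l \<Rightarrow> 'a \<Rightarrow> real" where
  "loglik f l x = ln (f l x)"

definition grad_loglik :: "(real^'p \<Rightarrow> 'a \<Rightarrow> real) \<Rightarrow> real^'p \<Rightarrow> 'a \<Rightarrow> real^'p" where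
  "grad_loglik f l x = partials (\<lambda>l'. loglik f l' x) l"

definition fisher_info ::
  "'a::euclidean_space set \<Rightarrow> (real^'p \<Rightarrow> 'a \<Rightarrow> real) \<Rightarrow> real^'p \<Rightarrow> real^'p^'p" where
  "fisher_info \<X> f l =
     (\<chi> j k. \<integral>x. grad_loglik f l x $ j * grad_loglik f l x $ k \<partial>density_law \<X> (f l))"

text \<open>Likelihood regularity at an interior parameter.  The existence of partial derivatives
  is asked of \<open>f\<close>, not of \<open>ln \<circ> f\<close>, since \<open>ln 0 = 0\<close>; where \<open>f l0 x > 0\<close>, hence almost
  everywhere under the law, it implies that of \<open>loglik\<close>.  With mean zero, the Fisher
  information is the covariance matrix of the gradient.\<close>

definition regular_likelihood_at ::
  "'a::euclidean_space set \<Rightarrow> (real^'p) set \<Rightarrow> (real^'p \<Rightarrow> 'a \<Rightarrow> real) \<Rightarrow> real^'p \<Rightarrow> bool" where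
  "regular_likelihood_at \<X> \<Lambda> f l0 \<longleftrightarrow>
     l0 \<in> interior \<Lambda> \<and>
     (AE x in density_law \<X> (f l0). \<forall>j. (\<lambda>t. f (l0 + t *\<^sub>R axis j 1) x) differentiable at 0) \<and>
     grad_loglik f l0 \<in> borel_measurable (density_law \<X> (f l0)) \<and>
     (\<forall>j. integrable (density_law \<X> (f l0)) (\<lambda>x. (grad_loglik f l0 x $ j)\<^sup>2)) \<and>
     (\<forall>j. (\<integral>x. grad_loglik f l0 x $ j \<partial>density_law \<X> (f l0)) = 0) \<and>
     invertible (fisher_info \<X> f l0)"

text \<open>The integrand is nonnegative, so the integral is taken in \<open>[0, \<infinity>]\<close>.  Division on
  \<open>ennreal\<close> has \<open>0 / 0 = 0\<close> and \<open>a / 0 = \<infinity>\<close> for \<open>a > 0\<close>.\<close>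

definition cov_psi ::
  "'a::euclidean_space set \<Rightarrow> ('l \<Rightarrow> 'a \<Rightarrow> real) \<Rightarrow> ('t \<Rightarrow> 'a \<Rightarrow> real) \<Rightarrow> 'l \<Rightarrow> 't \<Rightarrow> 't \<Rightarrow> ereal" where
  "cov_psi \<X> f \<psi> l0 t u =
     enn2ereal (\<integral>\<^sup>+x. ennreal (\<psi> t x * \<psi> u x) / ennreal (f l0 x) \<partial>restrict_space lborel \<X>) - 1"

definition cov_vec ::
  "'a::euclidean_space set \<Rightarrow> (real^'p \<Rightarrow> 'a \<Rightarrow> real) \<Rightarrow> ('t \<Rightarrow> 'a \<Rightarrow> real) \<Rightarrow> real^'p \<Rightarrow> 't \<Rightarrow> real^'p" where
  "cov_vec \<X> f \<psi> l0 t =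
     (\<chi> j. covariance (density_law \<X> (f l0)) (\<lambda>x. \<psi> t x / f l0 x - 1) (\<lambda>x. grad_loglik f l0 x $ j))"

definition score_process ::
  "('l \<Rightarrow> 'a \<Rightarrow> real) \<Rightarrow> ('t \<Rightarrow> 'a \<Rightarrow> real) \<Rightarrow> nat \<Rightarrow> (nat \<Rightarrow> 'w \<Rightarrow> 'a) \<Rightarrow> 't \<Rightarrow> 'l \<Rightarrow> 'w \<Rightarrow> real" where
  "score_process f \<psi> n X t l w = (\<Sum>i=1..n. \<psi> t (X i w) / f l (X i w) - 1)"

definition cov_star ::
  "'a::euclidean_space set \<Rightarrow> (real^'p \<Rightarrow> 'a \<Rightarrow> real) \<Rightarrow> ('t \<Rightarrow> 'a \<Rightarrow> real) \<Rightarrow> real^'p \<Rightarrow> 't \<Rightarrow> 't \<Rightarrow> ereal" where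
  "cov_star \<X> f \<psi> l0 t u =
     cov_psi \<X> f \<psi> l0 t u -
     ereal (cov_vec \<X> f \<psi> l0 t \<bullet> (matrix_inv (fisher_info \<X> f l0) *v cov_vec \<X> f \<psi> l0 u))"

end

theory Submission
  imports Defs
begin

text \<open>
  Write \<open>Y = \<psi>(X;\<theta>)/f(X;\<lambda>\<^sub>0) - 1\<close> and \<open>G = \<nabla>l(\<lambda>\<^sub>0|X)\<close> for a single observation. The process is
  \<open>n\<^sup>-\<^sup>1\<^sup>/\<^sup>2\<close> times a sum of \<open>n\<close> i.i.d. copies of the residual of \<open>Y\<close> after its linear projection onto
  the components of \<open>G\<close>. Independence kills the cross terms, and the covariance of two residuals is
  the covariance of the \<open>Y\<close>s minus the covariance of their projections. Finiteness of
  \<open>C(\<theta>,\<theta>)\<close> forces \<open>\<psi>(\<cdot>;\<theta>) = 0\<close> almost everywhere on \<open>f(\<cdot>;\<lambda>\<^sub>0) = 0\<close>, so that \<open>Y\<close> is centred.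
\<close>

section \<open>Square integrable functions\<close>

text \<open>Measurability is a separate conjunct because integrability of the square does not make
  \<open>f\<close> itself measurable.\<close>

definition square_integrable :: "'a measure \<Rightarrow> ('a \<Rightarrow> real) \<Rightarrow> bool" where
  "square_integrable M f \<longleftrightarrow> f \<in> borel_measurable M \<and> integrable M (\<lambda>x. (f x)\<^sup>2)"

lemma square_integrable_mult:
  assumes "square_integrable M f" "square_integrable M g"
  shows "integrable M (\<lambda>x. f x * g x)"
proof (rule Bochner_Integration.integrable_bound)
  show "integrable M (\<lambda>x. (f x)\<^sup>2 + (g x)\<^sup>2)"
    using assms by (auto simp: square_integrable_def)
  show "(\<lambda>x. f x * g x) \<in> borel_measurable M"
    using assms by (auto simp: square_integrable_def)
  have "\<bar>a * b\<bar> \<le> a\<^sup>2 + b\<^sup>2" for a b :: real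
    using sum_squares_bound[of "\<bar>a\<bar>" "\<bar>b\<bar>"] abs_ge_zero[of "a * b"]
    unfolding abs_mult power2_abs mult.assoc by linarith
  then show "AE x in M. norm (f x * g x) \<le> norm ((f x)\<^sup>2 + (g x)\<^sup>2)"
    by simp
qed

lemma square_integrable_add:
  assumes "square_integrable M f" "square_integrable M g"
  shows "square_integrable M (\<lambda>x. f x + g x)"
  using assms square_integrable_mult[OF assms]
  by (auto simp: square_integrable_def power2_sum mult.assoc)

lemma square_integrable_cmult:
  "square_integrable M f \<Longrightarrow> square_integrable M (\<lambda>x. c * f x)"
  by (auto simp: square_integrable_def power_mult_distrib)

lemma square_integrable_diff:
  assumes "square_integrable M f" "square_integrable M g"
  shows "square_integrable M (\<lambda>x. f x - g x)"
  using square_integrable_add[OF assms(1) square_integrable_cmult[OF assms(2), of "-1"]] by simp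

lemma square_integrable_sum:
  "(\<And>i. i \<in> I \<Longrightarrow> square_integrable M (f i)) \<Longrightarrow> square_integrable M (\<lambda>x. \<Sum>i\<in>I. f i x)"
  by (induction I rule: infinite_finite_induct)
     (auto intro: square_integrable_add simp: square_integrable_def[of M "\<lambda>x. 0"])

lemma square_integrable_inner:
  fixes G :: "'a \<Rightarrow> real^'p"
  assumes "\<And>j. square_integrable M (\<lambda>x. G x $ j)"
  shows "square_integrable M (\<lambda>x. a \<bullet> G x)"
  unfolding inner_vec_def inner_real_def
  by (intro square_integrable_sum square_integrable_cmult assms)

lemma (in finite_measure) square_integrable_integrable:
  "square_integrable M f \<Longrightarrow> integrable M f"
  unfolding square_integrable_def by (blast intro: square_integrable_imp_integrable)

lemma integral_mult_inner:
  fixes G :: "'a \<Rightarrow> real^'p"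
  assumes "square_integrable M h" "\<And>j. square_integrable M (\<lambda>x. G x $ j)"
  shows "(\<integral>x. h x * (a \<bullet> G x) \<partial>M) = a \<bullet> (\<chi> j. \<integral>x. h x * G x $ j \<partial>M)"
proof -
  have int: "integrable M (\<lambda>x. h x * G x $ j)" for j
    using assms by (rule square_integrable_mult)
  have "(\<integral>x. h x * (a \<bullet> G x) \<partial>M) = (\<integral>x. (\<Sum>j\<in>UNIV. a $ j * (h x * G x $ j)) \<partial>M)"
    by (simp add: inner_vec_def sum_distrib_left mult.left_commute)
  also have "\<dots> = (\<Sum>j\<in>UNIV. a $ j * (\<integral>x. h x * G x $ j \<partial>M))"
    using int by (subst Bochner_Integration.integral_sum) auto
  finally show ?thesis
    by (simp add: inner_vec_def)
qed

section \<open>Projection with a symmetric Gram matrix\<close>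

lemma matrix_inv_left_right:
  fixes A :: "real^'n^'n"
  assumes "invertible A"
  shows "A ** matrix_inv A = mat 1" "matrix_inv A ** A = mat 1"
proof -
  have "A ** matrix_inv A = mat 1 \<and> matrix_inv A ** A = mat 1"
    using assms unfolding invertible_def matrix_inv_def by (rule someI_ex)
  then show "A ** matrix_inv A = mat 1" "matrix_inv A ** A = mat 1" by auto
qed

text \<open>Transposing \<open>A ** matrix_inv A = mat 1\<close> makes the transposed inverse a left
  inverse of \<open>A\<close>, and a left inverse of an invertible matrix is its inverse.\<close>

lemma transpose_matrix_inv_symmetric:
  fixes A :: "real^'n^'n"
  assumes "invertible A" "transpose A = A"
  shows "transpose (matrix_inv A) = matrix_inv A"
proof -
  have "transpose (matrix_inv A) ** A = mat 1"
    using matrix_inv_left_right(1)[OF assms(1)] assms(2)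
    by (metis matrix_transpose_mul transpose_mat)
  then have "transpose (matrix_inv A) ** (A ** matrix_inv A) = matrix_inv A"
    by (simp add: matrix_mul_assoc)
  then show ?thesis
    by (simp add: matrix_inv_left_right(1)[OF assms(1)])
qed

text \<open>Used to shift the inverse Gram matrix from the random vector to the fixed
  coefficients.\<close>

lemma inner_matrix_vector_symmetric:
  fixes A :: "real^'n^'n"
  assumes "transpose A = A"
  shows "x \<bullet> (A *v y) = (A *v x) \<bullet> y"
  by (metis assms dot_lmul_matrix transpose_matrix_vector)

text \<open>\<open>g - c \<bullet> A\<^sup>-\<^sup>1 G\<close> is the residual of the least squares projection of \<open>g\<close> onto the span of
  the components of \<open>G\<close>; it is orthogonal to \<open>G\<close>.\<close>

lemma integral_residual_mult:
  fixes G :: "'a \<Rightarrow> real^'p" and A :: "real^'p^'p"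
  assumes G: "\<And>j. square_integrable M (\<lambda>x. G x $ j)"
    and A: "A = (\<chi> j k. \<integral>x. G x $ j * G x $ k \<partial>M)" "invertible A"
    and g: "square_integrable M g" "c = (\<chi> j. \<integral>x. g x * G x $ j \<partial>M)"
    and h: "square_integrable M h" "d = (\<chi> j. \<integral>x. h x * G x $ j \<partial>M)"
  shows "(\<integral>x. (g x - c \<bullet> (matrix_inv A *v G x)) * (h x - d \<bullet> (matrix_inv A *v G x)) \<partial>M) =
    (\<integral>x. g x * h x \<partial>M) - c \<bullet> (matrix_inv A *v d)"
proof -
  have "transpose A = A"
    by (simp add: A(1) transpose_def mult.commute)
  note sym = inner_matrix_vector_symmetric[OF transpose_matrix_inv_symmetric[OF A(2) this]]
  \<comment> \<open>By symmetry of the inverse, the two projections are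
    \<open>a \<bullet> G x\<close> and \<open>b \<bullet> G x\<close>.\<close>
  define a where "a = matrix_inv A *v c"
  define b where "b = matrix_inv A *v d"
  have aG: "square_integrable M (\<lambda>x. a \<bullet> G x)" and bG: "square_integrable M (\<lambda>x. b \<bullet> G x)"
    by (intro square_integrable_inner G)+
  \<comment> \<open>Normal equations: since \<open>A *v a = c\<close>, the projection of
    \<open>g\<close> has the same moments against \<open>G\<close> as \<open>g\<close>
    itself.\<close>
  have aGG: "(\<chi> j. \<integral>x. (a \<bullet> G x) * G x $ j \<partial>M) = c"
  proof (rule vector_eq_ldot[THEN iffD1], rule allI)
    fix z
    have "z \<bullet> (\<chi> j. \<integral>x. (a \<bullet> G x) * G x $ j \<partial>M) = (\<Sum>j\<in>UNIV. z $ j * (\<integral>x. G x $ j * (a \<bullet> G x) \<partial>M))"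
      by (simp add: inner_vec_def mult.commute)
    also have "\<dots> = (\<Sum>j\<in>UNIV. z $ j * (a \<bullet> A $ j))"
      by (simp add: integral_mult_inner G A(1))
    also have "\<dots> = z \<bullet> (A *v a)"
      by (simp add: inner_vec_def matrix_vector_mult_def mult.commute)
    also have "A *v a = c"
      by (simp add: a_def matrix_vector_mul_assoc matrix_inv_left_right A(2))
    finally show "z \<bullet> (\<chi> j. \<integral>x. (a \<bullet> G x) * G x $ j \<partial>M) = z \<bullet> c" .
  qed
  have "(\<integral>x. (g x - c \<bullet> (matrix_inv A *v G x)) * (h x - d \<bullet> (matrix_inv A *v G x)) \<partial>M) =
    (\<integral>x. g x * h x - g x * (b \<bullet> G x) - h x * (a \<bullet> G x) + (a \<bullet> G x) * (b \<bullet> G x) \<partial>M)"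
    unfolding sym a_def[symmetric] b_def[symmetric]
    by (intro Bochner_Integration.integral_cong) (auto simp: algebra_simps)
  also have "\<dots> = (\<integral>x. g x * h x \<partial>M) - (\<integral>x. g x * (b \<bullet> G x) \<partial>M)
      - (\<integral>x. h x * (a \<bullet> G x) \<partial>M) + (\<integral>x. (a \<bullet> G x) * (b \<bullet> G x) \<partial>M)"
    using g(1) h(1) aG bG by (simp add: square_integrable_mult)
  \<comment> \<open>Both \<open>g\<close> and its projection pair with \<open>b \<bullet> G\<close>
    to \<open>b \<bullet> c\<close>. These terms cancel, and what remains,
    \<open>a \<bullet> d\<close>, is the correction by symmetry.\<close>
  also have "\<dots> = (\<integral>x. g x * h x \<partial>M) - b \<bullet> c - a \<bullet> d + b \<bullet> c"
    using g h aG G by (simp add: integral_mult_inner aGG)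
  finally show ?thesis
    by (simp add: a_def sym)
qed

section \<open>Sums over an i.i.d. sample\<close>

text \<open>Expand the product into a double sum: each diagonal term is the moment under the common
  law \<open>P\<close>, and each off-diagonal term factors into two zero means. As the sums are
  centred, the product moment is their covariance.\<close>

lemma (in prob_space) covariance_sum_iid:
  fixes u v :: "'b \<Rightarrow> real"
  assumes indep: "indep_vars (\<lambda>_. N) X I" and I: "finite I" and sets: "sets P = sets N"
    and distr: "\<And>i. i \<in> I \<Longrightarrow> distr M N (X i) = P"
    and u: "square_integrable P u" "(\<integral>x. u x \<partial>P) = 0"
    and v: "square_integrable P v" "(\<integral>x. v x \<partial>P) = 0"
  shows "square_integrable M (\<lambda>w. \<Sum>i\<in>I. u (X i w))"
    and "(\<integral>w. (\<Sum>i\<in>I. u (X i w)) \<partial>M) = 0"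
    and "(\<integral>w. (\<Sum>i\<in>I. u (X i w)) * (\<Sum>i\<in>I. v (X i w)) \<partial>M) = card I * (\<integral>x. u x * v x \<partial>P)"
proof -
  have X: "X i \<in> measurable M N" if "i \<in> I" for i
    using indep that by (auto simp: indep_vars_def)
  have meas: "borel_measurable P = borel_measurable N"
    by (intro measurable_cong_sets sets refl)
  have um: "u \<in> borel_measurable N" and vm: "v \<in> borel_measurable N"
    using u(1) v(1) by (auto simp: square_integrable_def meas)
  have int: "integrable P h \<longleftrightarrow> integrable M (\<lambda>w. h (X i w))"
      "(\<integral>w. h (X i w) \<partial>M) = (\<integral>x. h x \<partial>P)"
    if "i \<in> I" "h \<in> borel_measurable N" for i and h :: "'b \<Rightarrow> real"
    using integrable_distr_eq[OF X[OF that(1)] that(2)] integral_distr[OF X[OF that(1)] that(2)]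
    by (auto simp: distr that)
  have sq: "square_integrable M (\<lambda>w. h (X i w))" if "i \<in> I" "square_integrable P h" for i h
  proof -
    have [measurable]: "h \<in> borel_measurable N" "X i \<in> measurable M N"
      using that X by (auto simp: square_integrable_def meas)
    show ?thesis
      using that int(1)[of i "\<lambda>x. (h x)\<^sup>2"] by (auto simp: square_integrable_def)
  qed
  show "square_integrable M (\<lambda>w. \<Sum>i\<in>I. u (X i w))"
    using sq u by (intro square_integrable_sum) auto
  show "(\<integral>w. (\<Sum>i\<in>I. u (X i w)) \<partial>M) = 0"
    using sq u um by (subst Bochner_Integration.integral_sum)
      (auto intro: square_integrable_integrable simp: int)
  have cross: "(\<integral>w. u (X i w) * v (X j w) \<partial>M) = (if j = i then \<integral>x. u x * v x \<partial>P else 0)"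
    if ij: "i \<in> I" "j \<in> I" for i j
  proof (cases "j = i")
    case True
    then show ?thesis using ij um vm by (simp add: int(2)[of i "\<lambda>x. u x * v x"])
  next
    case False
    \<comment> \<open>The product rule takes one function per index, so \<open>u\<close> is attached
      to \<open>i\<close> and \<open>v\<close> to the other index \<open>j\<close>.\<close>
    have "indep_vars (\<lambda>_. borel) (\<lambda>k w. (if k = i then u else v) (X k w)) {i, j}"
      using ij um vm by (intro indep_vars_compose2[OF indep_vars_subset[OF indep]]) auto
    then have "(\<integral>w. (\<Prod>k\<in>{i, j}. (if k = i then u else v) (X k w)) \<partial>M) =
        (\<Prod>k\<in>{i, j}. \<integral>w. (if k = i then u else v) (X k w) \<partial>M)"
      using ij sq u v by (intro indep_vars_lebesgue_integral)
        (auto intro!: square_integrable_integrable)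
    then show ?thesis
      using False ij u v um by (auto simp: int)
  qed
  have "(\<integral>w. (\<Sum>i\<in>I. u (X i w)) * (\<Sum>i\<in>I. v (X i w)) \<partial>M) =
      (\<Sum>i\<in>I. \<Sum>j\<in>I. \<integral>w. u (X i w) * v (X j w) \<partial>M)"
    using sq u v by (simp add: sum_product square_integrable_mult)
  also have "\<dots> = card I * (\<integral>x. u x * v x \<partial>P)"
    using I by (simp add: cross)
  finally show "(\<integral>w. (\<Sum>i\<in>I. u (X i w)) * (\<Sum>i\<in>I. v (X i w)) \<partial>M) =
      card I * (\<integral>x. u x * v x \<partial>P)" .
qed

section \<open>Density ratios under the null law\<close>

text \<open>The weight \<open>g\<close> cancels the denominator where it is positive. Where it
  vanishes the left side contributes nothing, and \<open>ac\<close> ensures the same for the right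
  side.\<close>

lemma nn_integral_density_ratio:
  fixes g :: "'a \<Rightarrow> real"
  assumes [measurable]: "g \<in> borel_measurable R" "h \<in> borel_measurable R"
    and nonneg: "\<And>x. x \<in> space R \<Longrightarrow> 0 \<le> g x" "\<And>x. x \<in> space R \<Longrightarrow> 0 \<le> h x"
    and ac: "AE x in R. g x = 0 \<longrightarrow> h x = 0"
  shows "(\<integral>\<^sup>+x. ennreal (h x / g x) \<partial>density R (\<lambda>x. ennreal (g x))) = (\<integral>\<^sup>+x. ennreal (h x) \<partial>R)"
proof -
  have "(\<integral>\<^sup>+x. ennreal (h x / g x) \<partial>density R (\<lambda>x. ennreal (g x))) =
      (\<integral>\<^sup>+x. ennreal (g x) * ennreal (h x / g x) \<partial>R)"
    by (simp add: nn_integral_density)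
  also have "\<dots> = (\<integral>\<^sup>+x. ennreal (h x) \<partial>R)"
    using ac AE_space[of R]
    by (intro nn_integral_cong_AE, eventually_elim) (auto simp: nonneg simp flip: ennreal_mult')
  finally show ?thesis .
qed

text \<open>Where \<open>g x = 0\<close>, assumption \<open>ac\<close> leaves \<open>0 / 0\<close>, which is \<open>0\<close> in \<open>ennreal\<close>; without it the
  right-hand side can be infinite.\<close>

lemma nn_integral_density_ratio_product:
  fixes g :: "'a \<Rightarrow> real"
  assumes [measurable]: "g \<in> borel_measurable R" "p \<in> borel_measurable R" "q \<in> borel_measurable R"
    and nonneg: "\<And>x. x \<in> space R \<Longrightarrow> 0 \<le> g x" "\<And>x. x \<in> space R \<Longrightarrow> 0 \<le> p x"
      "\<And>x. x \<in> space R \<Longrightarrow> 0 \<le> q x"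
    and ac: "AE x in R. g x = 0 \<longrightarrow> p x = 0"
  shows "(\<integral>\<^sup>+x. ennreal (p x / g x * (q x / g x)) \<partial>density R (\<lambda>x. ennreal (g x))) =
    (\<integral>\<^sup>+x. ennreal (p x * q x) / ennreal (g x) \<partial>R)"
proof -
  have eq: "ennreal (p x * q x / g x) = ennreal (p x * q x) / ennreal (g x)"
    if "g x = 0 \<longrightarrow> p x = 0" "x \<in> space R" for x
    using nonneg[OF that(2)] that(1) by (cases "g x = 0") (auto simp: divide_ennreal)
  have "(\<integral>\<^sup>+x. ennreal (p x / g x * (q x / g x)) \<partial>density R (\<lambda>x. ennreal (g x))) =
      (\<integral>\<^sup>+x. ennreal (p x * q x / g x) \<partial>R)"
    \<comment> \<open>The weight absorbs one of the two denominators. The numerator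
      \<open>p x * q x / g x\<close> meets the vanishing condition because real division by
      \<open>0\<close> yields \<open>0\<close>.\<close>
    using nn_integral_density_ratio[of g R "\<lambda>x. p x * q x / g x"] nonneg by simp
  also have "\<dots> = (\<integral>\<^sup>+x. ennreal (p x * q x) / ennreal (g x) \<partial>R)"
    using ac AE_space[of R] by (intro nn_integral_cong_AE, eventually_elim) (simp add: eq)
  finally show ?thesis .
qed

text \<open>Where \<open>f l0 x = 0\<close> and \<open>\<psi> t x > 0\<close> the integrand of
  \<open>cov_psi\<close> is \<infinity>, which a finite integral permits only on a null set.\<close>

lemma AE_zero_of_cov_psi_finite:
  assumes "prob_density_on \<X> (f l0)" "prob_density_on \<X> (\<psi> t)" "cov_psi \<X> f \<psi> l0 t t < \<infinity>"
  shows "AE x in restrict_space lborel \<X>. f l0 x = 0 \<longrightarrow> \<psi> t x = 0"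
proof -
  have [measurable]: "f l0 \<in> borel_measurable (restrict_space lborel \<X>)"
      "\<psi> t \<in> borel_measurable (restrict_space lborel \<X>)"
    using assms by (auto simp: prob_density_on_def)
  have "(\<integral>\<^sup>+x. ennreal (\<psi> t x * \<psi> t x) / ennreal (f l0 x) \<partial>restrict_space lborel \<X>) \<noteq> \<infinity>"
    using assms(3) by (auto simp: cov_psi_def)
  then have "AE x in restrict_space lborel \<X>. ennreal (\<psi> t x * \<psi> t x) / ennreal (f l0 x) \<noteq> \<infinity>"
    by (intro nn_integral_PInf_AE) measurable
  then show ?thesis
    by eventually_elim (auto simp: ennreal_eq_0_iff mult_le_0_iff split: if_splits)
qed

lemma prob_space_density_law:
  "prob_density_on \<X> g \<Longrightarrow> prob_space (density_law \<X> g)"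
  by (intro prob_spaceI)
     (auto simp: density_law_def prob_density_on_def emeasure_density cong: nn_integral_cong)

text \<open>The second moment of the ratio is the integral in
  \<open>cov_psi \<X> f \<psi> l0 t t\<close>; its mean is the total mass of
  \<open>\<psi> t\<close>, none of which lies where \<open>f l0\<close> vanishes.\<close>

lemma density_law_ratio:
  assumes "prob_density_on \<X> (f l0)" "prob_density_on \<X> (\<psi> t)" "cov_psi \<X> f \<psi> l0 t t < \<infinity>"
  shows "square_integrable (density_law \<X> (f l0)) (\<lambda>x. \<psi> t x / f l0 x)"
    and "(\<integral>x. \<psi> t x / f l0 x \<partial>density_law \<X> (f l0)) = 1"
proof -
  have [measurable]: "f l0 \<in> borel_measurable (restrict_space lborel \<X>)"
      "\<psi> t \<in> borel_measurable (restrict_space lborel \<X>)"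
    using assms by (auto simp: prob_density_on_def)
  have nonneg: "0 \<le> f l0 x" "0 \<le> \<psi> t x" if "x \<in> space (restrict_space lborel \<X>)" for x
    using assms that by (auto simp: prob_density_on_def space_restrict_space)
  note ac = AE_zero_of_cov_psi_finite[OF assms]
  have [measurable]: "f l0 \<in> borel_measurable (density_law \<X> (f l0))"
      "\<psi> t \<in> borel_measurable (density_law \<X> (f l0))"
    by (simp_all add: density_law_def)
  have "(\<integral>\<^sup>+x. ennreal (\<psi> t x / f l0 x * (\<psi> t x / f l0 x)) \<partial>density_law \<X> (f l0)) =
      (\<integral>\<^sup>+x. ennreal (\<psi> t x * \<psi> t x) / ennreal (f l0 x) \<partial>restrict_space lborel \<X>)"
    unfolding density_law_def by (rule nn_integral_density_ratio_product) (use nonneg ac in auto)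
  also have "\<dots> < \<infinity>"
    using assms(3) by (auto simp: cov_psi_def less_top[symmetric])
  finally show "square_integrable (density_law \<X> (f l0)) (\<lambda>x. \<psi> t x / f l0 x)"
    by (auto simp: square_integrable_def power2_eq_square intro!: integrableI_bounded)
  have "(\<integral>\<^sup>+x. ennreal (\<psi> t x / f l0 x) \<partial>density_law \<X> (f l0)) = 1"
    using nn_integral_density_ratio[OF _ _ nonneg ac] assms(2)
    by (simp add: density_law_def prob_density_on_def)
  moreover have "AE x in density_law \<X> (f l0). 0 \<le> \<psi> t x / f l0 x"
    using nonneg by (intro AE_I2) (auto simp: density_law_def)
  ultimately show "(\<integral>x. \<psi> t x / f l0 x \<partial>density_law \<X> (f l0)) = 1"
    by (simp add: integral_eq_nn_integral)
qed

lemma density_law_score: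
  assumes "prob_density_on \<X> (f l0)" "prob_density_on \<X> (\<psi> t)" "cov_psi \<X> f \<psi> l0 t t < \<infinity>"
  shows "square_integrable (density_law \<X> (f l0)) (\<lambda>x. \<psi> t x / f l0 x - 1)"
    and "(\<integral>x. \<psi> t x / f l0 x - 1 \<partial>density_law \<X> (f l0)) = 0"
proof -
  interpret P: prob_space "density_law \<X> (f l0)"
    by (rule prob_space_density_law[OF assms(1)])
  note ratio = density_law_ratio[OF assms]
  show "square_integrable (density_law \<X> (f l0)) (\<lambda>x. \<psi> t x / f l0 x - 1)"
    by (rule square_integrable_diff[OF ratio(1)]) (simp add: square_integrable_def)
  show "(\<integral>x. \<psi> t x / f l0 x - 1 \<partial>density_law \<X> (f l0)) = 0"
    using P.square_integrable_integrable[OF ratio(1)] by (simp add: ratio(2) P.prob_space)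
qed

text \<open>Turns the integral in [0, \<infinity>] into a real one. Finiteness for \<open>t\<close>
  and \<open>u\<close> together follows from the two diagonal values, since a product of square
  integrable ratios is integrable.\<close>

lemma cov_psi_eq_integral:
  assumes "prob_density_on \<X> (f l0)"
    and t: "prob_density_on \<X> (\<psi> t)" "cov_psi \<X> f \<psi> l0 t t < \<infinity>"
    and u: "prob_density_on \<X> (\<psi> u)" "cov_psi \<X> f \<psi> l0 u u < \<infinity>"
  shows "cov_psi \<X> f \<psi> l0 t u =
    ereal (\<integral>x. (\<psi> t x / f l0 x - 1) * (\<psi> u x / f l0 x - 1) \<partial>density_law \<X> (f l0))"
proof -
  interpret P: prob_space "density_law \<X> (f l0)"
    by (rule prob_space_density_law[OF assms(1)])
  note rt = density_law_ratio[OF assms(1) t] and ru = density_law_ratio[OF assms(1) u]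
  note int = P.square_integrable_integrable[OF rt(1)] P.square_integrable_integrable[OF ru(1)]
    square_integrable_mult[OF rt(1) ru(1)]
  let ?E = "\<integral>x. \<psi> t x / f l0 x * (\<psi> u x / f l0 x) \<partial>density_law \<X> (f l0)"
  have nonneg: "0 \<le> f l0 x" "0 \<le> \<psi> t x" "0 \<le> \<psi> u x" if "x \<in> \<X>" for x
    using assms that by (auto simp: prob_density_on_def)
  have space: "space (density_law \<X> (f l0)) = \<X>" "space (restrict_space lborel \<X>) = \<X>"
    by (auto simp: density_law_def space_restrict_space)
  have AE: "AE x in density_law \<X> (f l0). 0 \<le> \<psi> t x / f l0 x * (\<psi> u x / f l0 x)"
    using nonneg by (intro AE_I2) (auto simp: space)
  have "(\<integral>\<^sup>+x. ennreal (\<psi> t x * \<psi> u x) / ennreal (f l0 x) \<partial>restrict_space lborel \<X>) =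
      (\<integral>\<^sup>+x. ennreal (\<psi> t x / f l0 x * (\<psi> u x / f l0 x)) \<partial>density_law \<X> (f l0))"
    using nonneg AE_zero_of_cov_psi_finite[OF assms(1) t] assms unfolding density_law_def
    by (intro nn_integral_density_ratio_product[symmetric]) (auto simp: space prob_density_on_def)
  also have "\<dots> = ennreal ?E"
    by (rule nn_integral_eq_integral[OF int(3) AE])
  finally have "cov_psi \<X> f \<psi> l0 t u = ereal (?E - 1)"
    using integral_nonneg_AE[OF AE] by (simp add: cov_psi_def enn2ereal_ennreal one_ereal_def)
  \<comment> \<open>Both ratios have mean 1, so the added terms contribute -1 - 1 + 1.\<close>
  also have "?E - 1 = (\<integral>x. \<psi> t x / f l0 x * (\<psi> u x / f l0 x) - \<psi> t x / f l0 x - \<psi> u x / f l0 x + 1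
      \<partial>density_law \<X> (f l0))"
    using int by (simp add: rt ru P.prob_space)
  also have "\<dots> = (\<integral>x. (\<psi> t x / f l0 x - 1) * (\<psi> u x / f l0 x - 1) \<partial>density_law \<X> (f l0))"
    by (intro Bochner_Integration.integral_cong) (auto simp: algebra_simps)
  finally show ?thesis .
qed

section \<open>Covariance function of the projected process\<close>

theorem theorem6:
  fixes \<X> :: "(real^'s) set" and \<Lambda> :: "(real^'p) set" and \<Theta> :: "(real^'d) set"
    and f :: "real^'p \<Rightarrow> real^'s \<Rightarrow> real" and \<psi> :: "real^'d \<Rightarrow> real^'s \<Rightarrow> real"
    and l0 :: "real^'p" and M :: "'w measure" and X :: "nat \<Rightarrow> 'w \<Rightarrow> real^'s" and n :: nat
  assumes "\<X> \<in> sets borel"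
    and "\<And>l. l \<in> \<Lambda> \<Longrightarrow> prob_density_on \<X> (f l)"
    and "\<And>\<theta>. \<theta> \<in> \<Theta> \<Longrightarrow> prob_density_on \<X> (\<psi> \<theta>)"
    and "l0 \<in> \<Lambda>"
    and "regular_likelihood_at \<X> \<Lambda> f l0"
    and "prob_space M"
    and "n \<ge> 1"
    and "prob_space.indep_vars M (\<lambda>_. restrict_space lborel \<X>) X {1..n}"
    and "\<And>i. i \<in> {1..n} \<Longrightarrow>
           distributed M (restrict_space lborel \<X>) (X i) (\<lambda>x. ennreal (f l0 x))"
    and "\<And>\<theta>. \<theta> \<in> \<Theta> \<Longrightarrow> cov_psi \<X> f \<psi> l0 \<theta> \<theta> < \<infinity>"
    and "\<And>\<theta>. \<theta> \<in> \<Theta> \<Longrightarrow> supp_on \<X> (\<psi> \<theta>) \<subseteq> supp_on \<X> (f l0)"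
  shows "has_covariance_function M \<Theta>
           (\<lambda>\<theta> w. 1 / sqrt (real n) * score_process f \<psi> n X \<theta> l0 w -
                  1 / sqrt (real n) *
                    (cov_vec \<X> f \<psi> l0 \<theta> \<bullet>
                       (matrix_inv (fisher_info \<X> f l0) *v (\<Sum>i=1..n. grad_loglik f l0 (X i w)))))
           (cov_star \<X> f \<psi> l0)"
proof -
  interpret prob_space M by fact
  define P where "P = density_law \<X> (f l0)"
  define R where "R = restrict_space lborel \<X>"
  define G where "G = grad_loglik f l0"
  define A where "A = fisher_info \<X> f l0"
  define c where "c = cov_vec \<X> f \<psi> l0"
  define Y where "Y = (\<lambda>\<theta> x. \<psi> \<theta> x / f l0 x - 1)"
  \<comment> \<open>\<open>U\<close> is the contribution of a single observation, so that the
    process becomes the normalised sum \<open>Z\<close>.\<close>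
  define U where "U = (\<lambda>\<theta> x. Y \<theta> x - c \<theta> \<bullet> (matrix_inv A *v G x))"
  define Z where "Z = (\<lambda>\<theta> w. 1 / sqrt (real n) * (\<Sum>i=1..n. U \<theta> (X i w)))"
  note f = assms(2)[OF assms(4)]
  interpret P: prob_space P
    unfolding P_def by (rule prob_space_density_law[OF f])
  have sets: "sets P = sets R"
    by (simp add: P_def R_def density_law_def)
  have distr: "distr M R (X i) = P" if "i \<in> {1..n}" for i
    using assms(9)[OF that] by (simp add: distributed_def P_def R_def density_law_def)
  have A: "A = (\<chi> j k. \<integral>x. G x $ j * G x $ k \<partial>P)" "invertible A"
    using assms(5) by (auto simp: A_def G_def P_def fisher_info_def regular_likelihood_at_def)
  have G: "square_integrable P (\<lambda>x. G x $ j)" and G0: "(\<integral>x. G x $ j \<partial>P) = 0" for j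
    using assms(5)
    by (auto simp: regular_likelihood_at_def square_integrable_def P_def G_def cart_eq_inner_axis)
  \<comment> \<open>Taking the constant 1 as the other factor in \<open>integral_mult_inner\<close>
    reduces this mean to the means of the components.\<close>
  have aG0: "(\<integral>x. a \<bullet> G x \<partial>P) = 0" for a
    using integral_mult_inner[of P "\<lambda>_. 1" G a] G
    by (simp add: G0 square_integrable_def zero_vec_def[symmetric])
  have Y: "square_integrable P (Y \<theta>)" "(\<integral>x. Y \<theta> x \<partial>P) = 0" if "\<theta> \<in> \<Theta>" for \<theta>
    unfolding Y_def P_def
    using density_law_score[of \<X> f l0 \<psi> \<theta>] f assms(3,10) that by auto
  \<comment> \<open>\<open>cov_vec\<close> is defined by centred variables; as both means vanish, it
    is the vector of raw moments that the projection formula uses.\<close>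
  have c: "c \<theta> = (\<chi> j. \<integral>x. Y \<theta> x * G x $ j \<partial>P)" if "\<theta> \<in> \<Theta>" for \<theta>
    using Y(2)[OF that] G0
    by (simp add: c_def cov_vec_def covariance_def Y_def flip: P_def G_def)
  have cG: "square_integrable P (\<lambda>x. c \<theta> \<bullet> (matrix_inv A *v G x))"
      "(\<integral>x. c \<theta> \<bullet> (matrix_inv A *v G x) \<partial>P) = 0" for \<theta>
    \<comment> \<open>Moving the matrix to the left factor leaves a fixed vector paired with
      \<open>G x\<close>.\<close>
    unfolding dot_lmul_matrix[symmetric] by (intro square_integrable_inner G aG0)+
  have U: "square_integrable P (U \<theta>)" "(\<integral>x. U \<theta> x \<partial>P) = 0" if "\<theta> \<in> \<Theta>" for \<theta>
    using Y[OF that] cG[of \<theta>]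
    by (auto simp: U_def square_integrable_diff P.square_integrable_integrable)
  have UU: "ereal (\<integral>x. U \<theta> x * U \<theta>' x \<partial>P) = cov_star \<X> f \<psi> l0 \<theta> \<theta>'"
    if "\<theta> \<in> \<Theta>" "\<theta>' \<in> \<Theta>" for \<theta> \<theta>'
  proof -
    have "cov_psi \<X> f \<psi> l0 \<theta> \<theta>' = ereal (\<integral>x. Y \<theta> x * Y \<theta>' x \<partial>P)"
      unfolding Y_def P_def using f assms(3,10) that by (intro cov_psi_eq_integral) auto
    moreover have "(\<integral>x. U \<theta> x * U \<theta>' x \<partial>P) =
        (\<integral>x. Y \<theta> x * Y \<theta>' x \<partial>P) - c \<theta> \<bullet> (matrix_inv A *v c \<theta>')"
      unfolding U_def using that by (intro integral_residual_mult G A Y c)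
    ultimately show ?thesis
      by (simp add: cov_star_def A_def c_def)
  qed
  note iid = covariance_sum_iid[OF assms(8)[folded R_def] finite_atLeastAtMost sets distr]
  have Z: "square_integrable M (Z \<theta>)" "(\<integral>w. Z \<theta> w \<partial>M) = 0" if "\<theta> \<in> \<Theta>" for \<theta>
    unfolding Z_def using iid(1,2)[OF _ U[OF that] U[OF that]]
    by (auto intro!: square_integrable_cmult simp del: One_nat_def times_divide_eq_left mult_1)
  have "covariance M (Z \<theta>) (Z \<theta>') = (\<integral>x. U \<theta> x * U \<theta>' x \<partial>P)"
    if "\<theta> \<in> \<Theta>" "\<theta>' \<in> \<Theta>" for \<theta> \<theta>'
  proof -
    have "covariance M (Z \<theta>) (Z \<theta>') =
        (\<integral>w. 1 / real n * ((\<Sum>i=1..n. U \<theta> (X i w)) * (\<Sum>i=1..n. U \<theta>' (X i w))) \<partial>M)"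
      \<comment> \<open>The means vanish, and the two factors \<open>1 / sqrt (real n)\<close>
        combine to \<open>1 / real n\<close>, which cancels the sample size below because
        \<open>n \<ge> 1\<close>.\<close>
      using Z(2) that by (simp add: covariance_def) (simp add: Z_def flip: real_sqrt_mult)
    also have "\<dots> = 1 / real n * (real n * (\<integral>x. U \<theta> x * U \<theta>' x \<partial>P))"
      using iid(3)[OF _ U[OF that(1)] U[OF that(2)]] by simp
    finally show ?thesis using assms(7) by simp
  qed
  then have "has_covariance_function M \<Theta> Z (cov_star \<X> f \<psi> l0)"
    using Z(1) UU by (auto simp: has_covariance_function_def square_integrable_def)
  \<comment> \<open>Linearity of the matrix and of the inner product lets the projection of the
    summed gradients split over the observations.\<close>
  moreover have "Z = (\<lambda>\<theta> w. 1 / sqrt (real n) * score_process f \<psi> n X \<theta> l0 w -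
      1 / sqrt (real n) * (c \<theta> \<bullet> (matrix_inv A *v (\<Sum>i=1..n. G (X i w)))))"
    by (simp add: Z_def U_def Y_def score_process_def sum_subtractf right_diff_distrib
        inner_sum_right linear_sum[OF matrix_vector_mul_linear])
  ultimately show ?thesis
    by (simp only: A_def c_def G_def)
qed

end
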